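(* For all integers $n\geq 4$, $m(n,3,K_4-e)=\frac{1}{3}\left(\binom{n}{2}-f(n)\right)$, where $$f(n)=\begin{cases} n/2+6 & \text{if } n\equiv 0 \text{ or } 2 \pmod 6,\\ 9 & \text{if } n\equiv 1\text{ or } 3\pmod 6,\\ n/2+4 & \text{if } n\equiv 4\pmod 6,\\ 7 & \text{if } n\equiv 5\pmod 6.\end{cases}$$
   Context: A 2-$(n,3,1)$ packing is a pair $(X,\mathcal{A})$ with $|X|=n$ and $\mathcal{A}$ a set of 3-subsets (blocks) of $X$ such that every 2-subset of $X$ lies in at most one block. Its leave is the graph on $X$ whose edges are the 2-subsets of $X$ contained in no block. For a graph $G$, $m(n,3,G)$ is the maximum number of blocks of a 2-$(n,3,1)$ packing whose leave contains a subgraph isomorphic to $G$. $K_4-e$ is the complete graph on 4 vertices with one edge removed. *)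

theory Defs
  imports Complex_Main
begin

type_synonym 'a graph = "'a set \<times> 'a set set"

definition verts :: "'a graph \<Rightarrow> 'a set" where
  "verts G = fst G"

definition edges :: "'a graph \<Rightarrow> 'a set set" where
  "edges G = snd G"

definition two_subsets :: "'a set \<Rightarrow> 'a set set" where
  "two_subsets X = {e. e \<subseteq> X \<and> card e = 2}"

definition simple_graph :: "'a graph \<Rightarrow> bool" where
  "simple_graph G \<longleftrightarrow> finite (verts G) \<and> edges G \<subseteq> two_subsets (verts G)"

definition subgraph :: "'a graph \<Rightarrow> 'a graph \<Rightarrow> bool" where
  "subgraph H G \<longleftrightarrow>
     simple_graph H \<and> simple_graph G \<and> verts H \<subseteq> verts G \<and> edges H \<subseteq> edges G"

definition isomorphic :: "'a graph \<Rightarrow> 'b graph \<Rightarrow> bool" where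
  "isomorphic G H \<longleftrightarrow>
     (\<exists>\<phi>. bij_betw \<phi> (verts G) (verts H) \<and>
        (\<forall>u\<in>verts G. \<forall>v\<in>verts G. {u, v} \<in> edges G \<longleftrightarrow> {\<phi> u, \<phi> v} \<in> edges H))"

definition contains_copy :: "'a graph \<Rightarrow> 'b graph \<Rightarrow> bool" where
  "contains_copy L G \<longleftrightarrow> (\<exists>H. subgraph H L \<and> isomorphic H G)"

definition K4_minus_e :: "nat graph" where
  "K4_minus_e = ({..<4}, two_subsets {..<4} - {{0, 1}})"

text \<open>\<open>is_packing n k X A\<close>: the pair \<open>(X, A)\<close> is a 2-\<open>(n, k, 1)\<close> packing.\<close>

definition is_packing :: "nat \<Rightarrow> nat \<Rightarrow> 'a set \<Rightarrow> 'a set set \<Rightarrow> bool" where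
  "is_packing n k X A \<longleftrightarrow>
     finite X \<and> card X = n \<and>
     (\<forall>B\<in>A. B \<subseteq> X \<and> card B = k) \<and>
     (\<forall>e\<in>two_subsets X. card {B\<in>A. e \<subseteq> B} \<le> 1)"

definition leave :: "'a set \<Rightarrow> 'a set set \<Rightarrow> 'a graph" where
  "leave X A = (X, {e\<in>two_subsets X. \<not> (\<exists>B\<in>A. e \<subseteq> B)})"

text \<open>
  Point sets range over the finite sets of natural numbers; up to relabelling of points
  these give all packings. The value is meaningful only if some packing has a leave
  containing \<open>G\<close>, that is, for a simple graph \<open>G\<close> with at most \<open>n\<close> vertices (then the packing
  without blocks qualifies); \<open>Max {}\<close> is unspecified.
\<close>

definition max_packing :: "nat \<Rightarrow> nat \<Rightarrow> 'b graph \<Rightarrow> nat" where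
  "max_packing n k G =
     Max {card A | (X :: nat set) A. is_packing n k X A \<and> contains_copy (leave X A) G}"

definition leave_size :: "nat \<Rightarrow> real" where
  "leave_size n =
     (if n mod 6 = 0 \<or> n mod 6 = 2 then real n / 2 + 6
      else if n mod 6 = 1 \<or> n mod 6 = 3 then 9
      else if n mod 6 = 4 then real n / 2 + 4
      else 7)"

end

(*
  Upper bound: a vertex of the leave has degree congruent to n - 1 modulo 2. For even n all degrees
  are odd, and those of the four vertices of K4 - e are at least 3, so the leave has at least
  n/2 + 4 edges. For odd n the two vertices of degree 3 in K4 - e have degree at least 4, hence a
  neighbour outside, and the leave has at least 7 edges. The number of edges is determined modulo 3,
  which gives the stated values.

  Lower bound: in a Steiner triple system take a block {c, d, a} and a point b outside it. The
  blocks through {b, c} and {b, d} together with {c, d, a} contain a K4 - e, so removing three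
  blocks settles n = 1, 3 (mod 6). Deleting instead the third point of the block through {b, d}
  and removing only the two other blocks settles n = 0, 2. For n = 5 take a packing whose leave is
  a K5 and add a triple inside the K5; for n = 4 delete a point of the K5 from the packing of
  order n + 1.
*)

theory Submission
  imports Defs
begin

section \<open>Double counting in packings and their leaves\<close>

abbreviation leave_edges :: "'a set \<Rightarrow> 'a set set \<Rightarrow> 'a set set" where
  "leave_edges X A \<equiv> edges (leave X A)"

lemma leave_edges_eq: "leave_edges X A = {e \<in> two_subsets X. \<forall>B\<in>A. \<not> e \<subseteq> B}"
  by (auto simp: edges_def leave_def)

lemma finite_two_subsets [simp]: "finite X \<Longrightarrow> finite (two_subsets X)"
  by (simp add: two_subsets_def)

lemma card_two_subsets: "finite X \<Longrightarrow> card (two_subsets X) = card X choose 2"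
  by (simp add: two_subsets_def n_subsets)

lemma doubleton_in_two_subsets: "{x, y} \<in> two_subsets X \<longleftrightarrow> x \<in> X \<and> y \<in> X \<and> x \<noteq> y"
  by (auto simp: two_subsets_def card_insert_if)

lemma two_subsetsE:
  assumes "e \<in> two_subsets X"
  obtains x y where "e = {x, y}" "x \<in> X" "y \<in> X" "x \<noteq> y"
  using assms by (auto simp: two_subsets_def card_2_iff)

lemma card_star:
  assumes "finite X" "v \<in> X"
  shows "card {e \<in> two_subsets X. v \<in> e} = card X - 1"
proof -
  have "{e \<in> two_subsets X. v \<in> e} = (\<lambda>u. {v, u}) ` (X - {v})"
    using assms(2) by (force elim: two_subsetsE simp: doubleton_in_two_subsets)
  moreover have "inj_on (\<lambda>u. {v, u}) (X - {v})"
    by (auto simp: inj_on_def doubleton_eq_iff)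
  ultimately show ?thesis
    using assms by (simp add: card_image)
qed

lemma finite_blocks:
  assumes "finite X" "\<And>B. B \<in> A \<Longrightarrow> B \<subseteq> X"
  shows "finite A"
  using assms by (meson PowI finite_Pow_iff finite_subset subsetI)

lemma sum_block_incidence:
  assumes "finite S" "finite A"
  shows "(\<Sum>e\<in>S. card {B \<in> A. e \<subseteq> B}) = (\<Sum>B\<in>A. card {e \<in> S. e \<subseteq> B})"
  using assms by (simp add: sum_multicount_gen[where k = "\<lambda>B. card {e \<in> S. e \<subseteq> B}"])

text \<open>A pair in \<open>S\<close> lies either in the leave or in exactly one block, so summing
  over blocks counts each covered pair once. Taking all pairs for \<open>S\<close> gives the number
  of leave edges; taking the pairs through one point gives its degree in the leave.\<close>

lemma packing_count:
  assumes P: "is_packing n k X A" and S: "S \<subseteq> two_subsets X"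
  shows "card (S \<inter> leave_edges X A) + (\<Sum>B\<in>A. card {e \<in> S. e \<subseteq> B}) = card S"
proof -
  have fin: "finite X" "finite A"
    using P finite_blocks by (auto simp: is_packing_def)
  have finS: "finite S"
    using finite_subset[OF S] fin by simp
  have "card {B \<in> A. e \<subseteq> B} = (if e \<in> leave_edges X A then 0 else 1)" if "e \<in> S" for e
  proof (cases "e \<in> leave_edges X A")
    case True
    then have "{B \<in> A. e \<subseteq> B} = {}"
      by (auto simp: leave_edges_eq)
    then show ?thesis
      using True by (simp only: card.empty if_True)
  next
    case False
    then have "{B \<in> A. e \<subseteq> B} \<noteq> {}"
      using S that by (auto simp: leave_edges_eq)
    then have "card {B \<in> A. e \<subseteq> B} \<ge> 1"
      using fin by (simp add: Suc_le_eq card_gt_0_iff)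
    moreover have "card {B \<in> A. e \<subseteq> B} \<le> 1"
      using P S that by (auto simp: is_packing_def)
    ultimately show ?thesis
      using False by simp
  qed
  then have "(\<Sum>B\<in>A. card {e \<in> S. e \<subseteq> B}) = (\<Sum>e\<in>S. if e \<in> leave_edges X A then 0 else 1)"
    by (simp only: sum_block_incidence[OF finS fin(2), symmetric] cong: sum.cong)
  also have "\<dots> = card (S - leave_edges X A)"
    using finS by (simp add: sum.If_cases Diff_eq)
  finally show ?thesis
    using finS by (metis card_Diff_subset_Int card_mono finite_Int inf_le1 le_add_diff_inverse)
qed

lemma packing_card:
  assumes "is_packing n 3 X A"
  shows "3 * card A + card (leave_edges X A) = n choose 2"
proof -
  have "card {e \<in> two_subsets X. e \<subseteq> B} = 3" if "B \<in> A" for B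
  proof -
    have B: "B \<subseteq> X" "card B = 3"
      using assms that by (auto simp: is_packing_def)
    then have "{e \<in> two_subsets X. e \<subseteq> B} = two_subsets B"
      by (auto simp: two_subsets_def)
    moreover have "finite B"
      using B card.infinite by fastforce
    ultimately show ?thesis
      using B by (simp add: card_two_subsets choose_two)
  qed
  moreover have "two_subsets X \<inter> leave_edges X A = leave_edges X A"
    by (auto simp: leave_edges_eq)
  moreover have "card (two_subsets X) = n choose 2"
    using assms by (auto simp: is_packing_def card_two_subsets)
  ultimately show ?thesis
    using packing_count[OF assms subset_refl] by simp
qed

text \<open>The blocks through \<open>v\<close> split the covered pairs at \<open>v\<close> into
  twos. Hence every degree in the leave has the parity of \<open>n - 1\<close>.\<close>

lemma packing_degree:
  assumes P: "is_packing n 3 X A" and v: "v \<in> X"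
  shows "2 * card {B \<in> A. v \<in> B} + card {e \<in> leave_edges X A. v \<in> e} = n - 1"
proof -
  let ?S = "{e \<in> two_subsets X. v \<in> e}"
  have fin: "finite X" "finite A"
    using P finite_blocks by (auto simp: is_packing_def)
  have "card {e \<in> ?S. e \<subseteq> B} = (if v \<in> B then 2 else 0)" if "B \<in> A" for B
  proof (cases "v \<in> B")
    case True
    have B: "B \<subseteq> X" "card B = 3"
      using P that by (auto simp: is_packing_def)
    then have "{e \<in> ?S. e \<subseteq> B} = {e \<in> two_subsets B. v \<in> e}"
      by (auto simp: two_subsets_def)
    moreover have "finite B"
      using B card.infinite by fastforce
    ultimately show ?thesis
      using B True by (simp add: card_star)
  next
    case False
    then have "{e \<in> ?S. e \<subseteq> B} = {}"
      by auto
    then show ?thesis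
      using False by (simp only: card.empty if_False)
  qed
  then have "(\<Sum>B\<in>A. card {e \<in> ?S. e \<subseteq> B}) = (\<Sum>B\<in>A. if v \<in> B then 2 else 0)"
    by simp
  also have "\<dots> = 2 * card {B \<in> A. v \<in> B}"
    using fin by (simp add: sum.If_cases Int_def)
  finally have "(\<Sum>B\<in>A. card {e \<in> ?S. e \<subseteq> B}) = 2 * card {B \<in> A. v \<in> B}" .
  moreover have "?S \<inter> leave_edges X A = {e \<in> leave_edges X A. v \<in> e}"
    by (auto simp: leave_edges_eq)
  moreover have "card ?S = n - 1"
    using P v by (auto simp: is_packing_def card_star)
  ultimately show ?thesis
    using packing_count[OF P, of ?S] by auto
qed

lemma handshake:
  assumes "finite X" "L \<subseteq> two_subsets X"
  shows "(\<Sum>v\<in>X. card {e \<in> L. v \<in> e}) = 2 * card L"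
proof (rule sum_multicount)
  show "finite L"
    using assms finite_subset finite_two_subsets by blast
  show "\<forall>e\<in>L. card {v \<in> X. v \<in> e} = 2"
  proof
    fix e
    assume "e \<in> L"
    then have "{v \<in> X. v \<in> e} = e" "card e = 2"
      using assms by (auto simp: two_subsets_def)
    then show "card {v \<in> X. v \<in> e} = 2"
      by simp
  qed
qed (use assms in auto)

text \<open>
  If the blocks cover all pairs outside \<open>L\<close> and there are no more of them than double counting
  allows, no pair can be covered twice. So a construction needs only coverage and a crude
  bound on the number of blocks.
\<close>

lemma covering_imp_packing:
  assumes X: "finite X" "card X = n"
    and blocks: "\<And>B. B \<in> A \<Longrightarrow> B \<subseteq> X \<and> card B = 3"
    and cover: "\<And>x y. x \<in> X \<Longrightarrow> y \<in> X \<Longrightarrow> x \<noteq> y \<Longrightarrow> {x, y} \<notin> L \<Longrightarrow> \<exists>B\<in>A. {x, y} \<subseteq> B"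
    and L: "L \<subseteq> two_subsets X"
    and bound: "3 * card A + card L \<le> n choose 2"
  shows "is_packing n 3 X A \<and> leave_edges X A = L"
proof -
  have fin: "finite A" "finite (two_subsets X)" "finite L"
    using X finite_blocks blocks L finite_subset finite_two_subsets by metis+
  \<comment> \<open>\<open>c e\<close> is how often \<open>e\<close> is covered, \<open>d e\<close>
    how often it has to be covered at least.\<close>
  define c where "c e = card {B \<in> A. e \<subseteq> B}" for e
  define d where "d e = (if e \<in> L then 0 else 1 :: nat)" for e
  have "card {e \<in> two_subsets X. e \<subseteq> B} = 3" if "B \<in> A" for B
  proof -
    have "{e \<in> two_subsets X. e \<subseteq> B} = two_subsets B" "finite B"
      using blocks[OF that] X by (auto simp: two_subsets_def intro: finite_subset)
    then show ?thesis
      using blocks[OF that] by (simp add: card_two_subsets choose_two)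
  qed
  then have "sum c (two_subsets X) = 3 * card A"
    unfolding c_def using sum_block_incidence[OF fin(2,1)] by simp
  moreover have "sum d (two_subsets X) = (n choose 2) - card L"
  proof -
    have "sum d (two_subsets X) = card (two_subsets X - L)"
      using fin by (simp add: d_def sum.If_cases Diff_eq)
    then show ?thesis
      using fin L X by (simp add: card_Diff_subset card_two_subsets)
  qed
  moreover have le: "d e \<le> c e" if e: "e \<in> two_subsets X" for e
  proof (cases "e \<in> L")
    case False
    then have "{B \<in> A. e \<subseteq> B} \<noteq> {}"
      using cover e by (auto elim!: two_subsetsE)
    then show ?thesis
      using fin False by (simp add: c_def d_def Suc_le_eq card_gt_0_iff)
  qed (simp add: d_def)
  \<comment> \<open>\<open>d \<le> c\<close> holds pointwise, while \<open>bound\<close> bounds the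
    total of \<open>c\<close> by that of \<open>d\<close>; so the totals agree, and then so do all
    the terms.\<close>
  ultimately have "sum c (two_subsets X) = sum d (two_subsets X)"
    using bound sum_mono[of "two_subsets X" d c] by auto
  then have eq: "c e = d e" if "e \<in> two_subsets X" for e
    using sum_mono_inv[of d "two_subsets X" c e] le fin that by auto
  have "is_packing n 3 X A"
    using X blocks eq by (auto simp: is_packing_def c_def d_def)
  moreover have "leave_edges X A = L"
  proof -
    have "e \<in> L \<longleftrightarrow> (\<forall>B\<in>A. \<not> e \<subseteq> B)" if "e \<in> two_subsets X" for e
    proof -
      have "e \<in> L \<longleftrightarrow> c e = 0"
        using eq[OF that] by (simp add: d_def)
      also have "\<dots> \<longleftrightarrow> {B \<in> A. e \<subseteq> B} = {}"
        using fin by (simp add: c_def)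
      finally show ?thesis
        by blast
    qed
    then show ?thesis
      using L by (auto simp: leave_edges_eq)
  qed
  ultimately show ?thesis
    by blast
qed

section \<open>Copies of K4 - e in a leave\<close>

text \<open>The points \<open>a\<close>, \<open>b\<close>, \<open>c\<close>, \<open>d\<close> play
  the vertices 0, 1, 2, 3: \<open>c\<close> and \<open>d\<close> have degree 3, and
  \<open>{a, b}\<close> is the removed edge. A copy need not be induced, so \<open>{a, b}\<close>
  may or may not belong to the leave.\<close>

lemma contains_copy_K4_minus_e:
  assumes "finite X"
  shows "contains_copy (leave X A) K4_minus_e \<longleftrightarrow>
    (\<exists>a b c d. distinct [a, b, c, d] \<and>
      {{a, c}, {a, d}, {b, c}, {b, d}, {c, d}} \<subseteq> leave_edges X A)" (is "?L \<longleftrightarrow> ?R")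
proof
  assume ?L
  then obtain H where H: "subgraph H (leave X A)" "isomorphic H K4_minus_e"
    by (auto simp: contains_copy_def)
  then obtain \<phi> where \<phi>: "bij_betw \<phi> (verts H) (verts K4_minus_e)"
    "\<forall>u\<in>verts H. \<forall>v\<in>verts H. {u, v} \<in> edges H \<longleftrightarrow> {\<phi> u, \<phi> v} \<in> edges K4_minus_e"
    by (auto simp: isomorphic_def)
  \<comment> \<open>The inverse isomorphism names the four vertices of the copy.\<close>
  define g where "g = inv_into (verts H) \<phi>"
  have V: "verts K4_minus_e = {..<4}"
    by (simp add: K4_minus_e_def verts_def)
  have g: "g i \<in> verts H" "\<phi> (g i) = i" if "i < 4" for i
    using \<phi>(1) V that unfolding g_def
    by (auto simp: bij_betw_def inv_into_into f_inv_into_f)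
  have E: "{i, j} \<in> edges K4_minus_e \<longleftrightarrow> i < 4 \<and> j < 4 \<and> i \<noteq> j \<and> {i, j} \<noteq> {0, 1}" for i j
    by (auto simp: K4_minus_e_def edges_def doubleton_in_two_subsets)
  have edge: "{g i, g j} \<in> leave_edges X A"
    if "i < 4" "j < 4" "i \<noteq> j" "{i, j} \<noteq> {0, 1}" for i j
  proof -
    have "{i, j} \<in> edges K4_minus_e"
      using that by (simp only: E simp_thms)
    moreover have "{g i, g j} \<in> edges H \<longleftrightarrow> {\<phi> (g i), \<phi> (g j)} \<in> edges K4_minus_e"
      by (intro \<phi>(2)[rule_format] g(1) that)
    ultimately have "{g i, g j} \<in> edges H"
      using g(2) that by (simp only:)
    then show ?thesis
      using H(1) by (auto simp: subgraph_def)
  qed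
  have "distinct [g 0, g 1, g 2, g 3]"
    using g(2)[of 0] g(2)[of 1] g(2)[of 2] g(2)[of 3] by auto
  moreover have "{{g 0, g 2}, {g 0, g 3}, {g 1, g 2}, {g 1, g 3}, {g 2, g 3}} \<subseteq> leave_edges X A"
    by (auto intro!: edge simp: doubleton_eq_iff)
  ultimately show ?R
    by blast
next
  assume ?R
  then obtain a b c d where abcd: "distinct [a, b, c, d]"
    "{{a, c}, {a, d}, {b, c}, {b, d}, {c, d}} \<subseteq> leave_edges X A"
    by (elim exE conjE) (rule that)
  \<comment> \<open>\<open>{a, b}\<close> is taken out explicitly, in case it is an edge of the
    leave.\<close>
  define H where "H = ({a, b, c, d}, two_subsets {a, b, c, d} - {{a, b}})"
  have "edges H \<subseteq> leave_edges X A"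
  proof
    fix e
    assume "e \<in> edges H"
    then obtain u v where "e = {u, v}" "u \<in> {a, b, c, d}" "v \<in> {a, b, c, d}" "u \<noteq> v" "{u, v} \<noteq> {a, b}"
      by (auto simp: H_def edges_def elim!: two_subsetsE)
    then have "e \<in> {{a, c}, {a, d}, {b, c}, {b, d}, {c, d}}"
      by (elim insertE emptyE) (simp_all add: insert_commute)
    then show "e \<in> leave_edges X A"
      using abcd(2) by blast
  qed
  moreover have "{a, b, c, d} \<subseteq> X"
    using abcd by (auto simp: leave_edges_eq doubleton_in_two_subsets subset_iff)
  ultimately have "subgraph H (leave X A)"
    using assms by (auto simp: subgraph_def simple_graph_def H_def verts_def edges_def leave_def)
  moreover have "isomorphic H K4_minus_e"
  proof -
    define \<phi> :: "'a \<Rightarrow> nat"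
      where "\<phi> x = (if x = a then 0 else if x = b then 1 else if x = c then 2 else 3)" for x
    have "{..<4} = {0, 1, 2, 3 :: nat}"
      by auto
    then have bij: "bij_betw \<phi> {a, b, c, d} {..<4}"
      using abcd(1) by (auto simp: bij_betw_def inj_on_def \<phi>_def)
    have "{u, v} \<in> edges H \<longleftrightarrow> {\<phi> u, \<phi> v} \<in> edges K4_minus_e"
      if uv: "u \<in> {a, b, c, d}" "v \<in> {a, b, c, d}" for u v
    proof -
      have inj: "inj_on \<phi> {a, b, c, d}"
        using bij by (rule bij_betw_imp_inj_on)
      \<comment> \<open>An edge on either side is a pair of distinct vertices other than the
        excluded pair; injectivity of \<open>\<phi>\<close> carries over both conditions.\<close>
      have "{u, v} = {a, b} \<longleftrightarrow> \<phi> ` {u, v} = \<phi> ` {a, b}"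
        using uv by (intro inj_on_image_eq_iff[OF inj, symmetric]) auto
      also have "\<phi> ` {u, v} = {\<phi> u, \<phi> v}"
        by simp
      also have "\<phi> ` {a, b} = {0, 1}"
        using abcd(1) by (auto simp: \<phi>_def)
      finally have "{u, v} = {a, b} \<longleftrightarrow> {\<phi> u, \<phi> v} = {0, 1}" .
      moreover have "u = v \<longleftrightarrow> \<phi> u = \<phi> v"
        using inj uv by (simp only: inj_on_eq_iff)
      moreover have "\<phi> u \<in> {..<4}" "\<phi> v \<in> {..<4}"
        using uv bij_betwE[OF bij] by blast+
      ultimately show ?thesis
        using uv unfolding H_def K4_minus_e_def edges_def
        by (simp only: snd_conv Diff_iff doubleton_in_two_subsets singleton_iff)
    qed
    then show ?thesis
      using bij by (auto simp: isomorphic_def H_def K4_minus_e_def verts_def simp del: insert_iff)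
  qed
  ultimately show ?L
    unfolding contains_copy_def by blast
qed

subsection \<open>The upper bound\<close>

text \<open>The degree sum is twice the number of edges. Parity raises the degrees forced by the
  copy, and the points outside the copy contribute the rest.\<close>

lemma leave_with_K4_minus_e_bound:
  assumes P: "is_packing n 3 X A" and C: "contains_copy (leave X A) K4_minus_e"
  shows "even n \<Longrightarrow> n + 8 \<le> 2 * card (leave_edges X A)"
    and "odd n \<Longrightarrow> 7 \<le> card (leave_edges X A)"
proof -
  have X: "finite X" "card X = n"
    using P by (auto simp: is_packing_def)
  define L where "L = leave_edges X A"
  define deg where "deg v = card {e \<in> L. v \<in> e}" for v
  have L: "L \<subseteq> two_subsets X"
    by (auto simp: leave_edges_eq L_def)
  then have finL: "finite L"
    using finite_subset[OF L] X by simp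
  obtain a b c d where abcd: "distinct [a, b, c, d]"
    "{{a, c}, {a, d}, {b, c}, {b, d}, {c, d}} \<subseteq> leave_edges X A"
    using C unfolding contains_copy_K4_minus_e[OF X(1)] by (elim exE conjE) (rule that)
  note abcd = abcd[folded L_def]
  have inX: "{a, b, c, d} \<subseteq> X"
  proof -
    have "{a, c} \<in> two_subsets X" "{b, d} \<in> two_subsets X"
      using abcd(2) L by blast+
    then show ?thesis
      by (simp add: doubleton_in_two_subsets)
  qed
  have sum: "2 * card L = (\<Sum>v\<in>X. deg v)"
    unfolding deg_def using handshake[OF X(1) L] by simp
  have par: "even (deg v) \<longleftrightarrow> odd n" if "v \<in> X" for v
  proof -
    have "2 * card {B \<in> A. v \<in> B} + deg v = n - 1"
      using packing_degree[OF P that] by (simp add: deg_def L_def)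
    \<comment> \<open>For \<open>n = 0\<close> the truncated \<open>n - 1\<close> would have the
      wrong parity.\<close>
    moreover have "n \<noteq> 0"
      using X that by (auto simp: card_gt_0_iff)
    ultimately show ?thesis
      by presburger
  qed
  have degI: "card S \<le> deg v" if "S \<subseteq> {e \<in> L. v \<in> e}" for S v
    unfolding deg_def using that finL by (auto intro: card_mono)
  have "card {{a, c}, {a, d}} \<le> deg a" "card {{b, c}, {b, d}} \<le> deg b"
    "card {{a, c}, {b, c}, {c, d}} \<le> deg c" "card {{a, d}, {b, d}, {c, d}} \<le> deg d"
    using abcd by (intro degI; auto)+
  then have ge: "2 \<le> deg a" "2 \<le> deg b" "3 \<le> deg c" "3 \<le> deg d"
    using abcd(1) by (auto simp: card_insert_if doubleton_eq_iff)
  have split: "(\<Sum>v\<in>X. deg v) = deg a + deg b + deg c + deg d + (\<Sum>v\<in>X - {a, b, c, d}. deg v)"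
    using sum.subset_diff[OF inX X(1), of deg] abcd(1) by simp
  {
    assume n: "even n"
    have odd: "odd (deg v)" if "v \<in> X" for v
      using par[OF that] n by simp
    \<comment> \<open>Being odd, the degrees of \<open>a\<close> and \<open>b\<close> are at least 3
      as well, and every other point has degree at least 1: the sum is at least 4 * 3 + (n - 4) = n
      + 8.\<close>
    have "deg a \<noteq> 2" "deg b \<noteq> 2"
      using odd inX by force+
    moreover have "card (X - {a, b, c, d}) = n - 4" "4 \<le> n"
      using X abcd(1) inX card_mono[OF X(1) inX] by (auto simp: card_Diff_subset)
    moreover have "(\<Sum>v\<in>X - {a, b, c, d}. 1) \<le> (\<Sum>v\<in>X - {a, b, c, d}. deg v)"
      using odd by (intro sum_mono) (auto simp: Suc_le_eq odd_pos)
    ultimately have "n + 8 \<le> 2 * card L"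
      using sum split ge by simp
    then show "n + 8 \<le> 2 * card (leave_edges X A)"
      by (simp add: L_def)
  }
  {
    assume n: "odd n"
    have even: "even (deg v)" if "v \<in> X" for v
      using par[OF that] n by simp
    have "deg c \<noteq> 3" "deg d \<noteq> 3"
      using even inX by force+
    then have ge4: "4 \<le> deg c" "4 \<le> deg d"
      using ge by auto
    \<comment> \<open>The copy uses only three edges at \<open>c\<close>, so a fourth one leads to a
      point \<open>w\<close> outside the copy.\<close>
    have "\<not> {e \<in> L. c \<in> e} \<subseteq> {{a, c}, {b, c}, {c, d}}"
    proof
      assume "{e \<in> L. c \<in> e} \<subseteq> {{a, c}, {b, c}, {c, d}}"
      then have "deg c \<le> card {{a, c}, {b, c}, {c, d}}"
        unfolding deg_def by (intro card_mono) auto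
      also have "\<dots> \<le> 3"
        by (simp add: card_insert_if)
      finally show False
        using ge4 by simp
    qed
    then obtain e where e: "e \<in> L" "c \<in> e" "e \<notin> {{a, c}, {b, c}, {c, d}}"
      by auto
    then obtain w where w: "e = {c, w}" "w \<in> X" "w \<noteq> c"
      using L by (auto simp: subset_iff elim!: two_subsetsE)
    then have w': "w \<in> X - {a, b, c, d}"
      using e by auto
    have "deg w \<noteq> 0"
      unfolding deg_def using finL e w by auto
    then have "2 \<le> deg w"
      using even[OF w(2)] by presburger
    \<comment> \<open>With the contribution of \<open>w\<close> the degree sum is at least 2 + 2 + 4
      + 4 + 2 = 14.\<close>
    moreover have "deg w \<le> (\<Sum>v\<in>X - {a, b, c, d}. deg v)"
      using w' X by (intro member_le_sum) auto
    ultimately have "7 \<le> card L"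
      using sum split ge ge4 by simp
    then show "7 \<le> card (leave_edges X A)"
      by (simp add: L_def)
  }
qed

section \<open>Binomial coefficients and leave sizes modulo 6\<close>

lemma choose_two_mod_6:
  "6 * q choose 2 = 18 * q^2 - 3 * q"
  "(6 * q + 1) choose 2 = 18 * q^2 + 3 * q"
  "(6 * q + 2) choose 2 = 18 * q^2 + 9 * q + 1"
  "(6 * q + 3) choose 2 = 18 * q^2 + 15 * q + 3"
  "(6 * q + 4) choose 2 = 18 * q^2 + 21 * q + 6"
  "(6 * q + 5) choose 2 = 18 * q^2 + 27 * q + 10"
proof -
  have *: "m choose 2 = x" if "m * (m - 1) = 2 * x" for m x :: nat
    using that by (simp add: choose_two)
  show "6 * q choose 2 = 18 * q^2 - 3 * q"
    by (rule *) (simp add: algebra_simps power2_eq_square diff_mult_distrib2)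
qed (simp_all add: choose_two algebra_simps power2_eq_square)

text \<open>An integral version of \<open>leave_size\<close>: \<open>n\<close> is even wherever its
  half occurs, so \<open>div\<close> is exact and the counting can stay within the natural
  numbers.\<close>

definition leave_size_nat :: "nat \<Rightarrow> nat" where
  "leave_size_nat n =
     (if n mod 6 = 0 \<or> n mod 6 = 2 then n div 2 + 6
      else if n mod 6 = 1 \<or> n mod 6 = 3 then 9
      else if n mod 6 = 4 then n div 2 + 4
      else 7)"

lemma leave_size_eq: "leave_size n = real (leave_size_nat n)"
proof -
  have "real (n div 2) = real n / 2" if "n mod 6 \<in> {0, 2, 4}"
  proof -
    have "even n"
      using that by (auto simp: even_iff_mod_2_eq_zero) presburger+
    then show ?thesis
      by (simp add: real_of_nat_div)
  qed
  then show ?thesis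
    by (auto simp: leave_size_def leave_size_nat_def)
qed

lemma mod_6_cases:
  obtains q where "(n::nat) = 6 * q" | q where "n = 6 * q + 1" | q where "n = 6 * q + 2"
  | q where "n = 6 * q + 3" | q where "n = 6 * q + 4" | q where "n = 6 * q + 5"
proof -
  have "n = 6 * (n div 6) + n mod 6" "n mod 6 < 6"
    by auto
  moreover have "n mod 6 \<in> {0, 1, 2, 3, 4, 5}"
    using \<open>n mod 6 < 6\<close> by auto
  ultimately show ?thesis
    using that by (metis add_0_right empty_iff insert_iff)
qed

lemma mod_6_simps:
  "(6 * q + 1) mod 6 = (1::nat)" "(6 * q + 2) mod 6 = (2::nat)" "(6 * q + 3) mod 6 = (3::nat)"
  "(6 * q + 4) mod 6 = (4::nat)" "(6 * q + 5) mod 6 = (5::nat)"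
  by presburger+

text \<open>The number of leave edges is congruent to \<open>n choose 2\<close> modulo 3. For
  residues 0, 2 this lifts the degree bound n/2 + 4 to n/2 + 6, for 1, 3 it lifts 7 to 9; for 4 and
  5 the degree bound is already the stated value.\<close>

lemma packing_with_K4_minus_e_bound:
  assumes P: "is_packing n 3 X A" and C: "contains_copy (leave X A) K4_minus_e"
  shows "3 * card A + leave_size_nat n \<le> n choose 2"
proof -
  note count = packing_card[OF P] and bound = leave_with_K4_minus_e_bound[OF P C]
  let ?l = "card (leave_edges X A)"
  have "leave_size_nat n \<le> ?l"
  proof (cases n rule: mod_6_cases)
    case (1 q)
    \<comment> \<open>Ensures that \<open>18 * q^2 - 3 * q\<close> is not truncated.\<close>
    have "q \<le> q^2"
      by (simp add: power2_nat_le_imp_le power2_eq_square)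
    then have "3 * card A + ?l + 3 * q = 18 * q^2" "6 * q + 8 \<le> 2 * ?l"
      using count bound unfolding 1 choose_two_mod_6 by auto
    then have "3 * q + 6 \<le> ?l"
      by presburger
    then show ?thesis
      using 1 by (simp add: leave_size_nat_def)
  next
    case (2 q)
    have "3 * card A + ?l = 18 * q^2 + 3 * q" "7 \<le> ?l"
      using count bound unfolding 2 choose_two_mod_6 by auto
    then have "9 \<le> ?l"
      by presburger
    then show ?thesis
      unfolding 2 leave_size_nat_def mod_6_simps by simp
  next
    case (3 q)
    have "3 * card A + ?l = 18 * q^2 + 9 * q + 1" "6 * q + 2 + 8 \<le> 2 * ?l"
      using count bound unfolding 3 choose_two_mod_6 by auto
    then have "3 * q + 7 \<le> ?l"
      by presburger
    then show ?thesis
      unfolding 3 leave_size_nat_def mod_6_simps by simp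
  next
    case (4 q)
    have "3 * card A + ?l = 18 * q^2 + 15 * q + 3" "7 \<le> ?l"
      using count bound unfolding 4 choose_two_mod_6 by auto
    then have "9 \<le> ?l"
      by presburger
    then show ?thesis
      unfolding 4 leave_size_nat_def mod_6_simps by simp
  next
    case (5 q)
    show ?thesis
      using bound(1) unfolding 5 leave_size_nat_def mod_6_simps by simp
  next
    case (6 q)
    show ?thesis
      using bound(2) unfolding 6 leave_size_nat_def mod_6_simps by simp
  qed
  then show ?thesis
    using count by simp
qed

subsection \<open>Steiner triple systems and their analogue for order \<open>6 * k + 5\<close>\<close>

text \<open>
  \<open>pt i t\<close> encodes the point \<open>(i, t)\<close> of \<open>{..<m} \<times> {0, 1, 2}\<close>; the numbers from \<open>3 * m\<close> on
  serve as points at infinity.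
\<close>

definition pt :: "nat \<Rightarrow> nat \<Rightarrow> nat" where
  "pt i t = 3 * i + t"

lemma pt_eq_iff: "s < 3 \<Longrightarrow> t < 3 \<Longrightarrow> pt i s = pt j t \<longleftrightarrow> i = j \<and> s = t"
  unfolding pt_def by presburger

lemma pt_less: "t < 3 \<Longrightarrow> pt i t < 3 * m \<longleftrightarrow> i < m"
  unfolding pt_def by presburger

lemma ptE:
  assumes "x < 3 * m"
  obtains i t where "x = pt i t" "i < m" "t < 3"
  using that[of "x div 3" "x mod 3"] assms by (auto simp: pt_def)

text \<open>
  \<open>qblocks m f\<close> covers every pair of points except \<open>(i, t)\<close> and \<open>(f t i i, t + 1)\<close>, provided
  each \<open>f t\<close> is a commutative quasigroup.
\<close>

definition qblocks :: "nat \<Rightarrow> (nat \<Rightarrow> nat \<Rightarrow> nat \<Rightarrow> nat) \<Rightarrow> nat set set" where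
  "qblocks m f = (\<lambda>((j, i), t). {pt i t, pt j t, pt (f t i j) (Suc t mod 3)}) `
     ((SIGMA j:{..<m}. {..<j}) \<times> {..<3})"

text \<open>Only solvability of \<open>f i x = j\<close> is demanded; on the finite set
  \<open>{..<m}\<close> the solution is then unique.\<close>

definition comm_quasigroup :: "nat \<Rightarrow> (nat \<Rightarrow> nat \<Rightarrow> nat) \<Rightarrow> bool" where
  "comm_quasigroup m f \<longleftrightarrow>
     (\<forall>i<m. \<forall>j<m. f i j < m \<and> f i j = f j i \<and> (\<exists>x<m. f i x = j))"

lemma comm_quasigroupD:
  assumes "comm_quasigroup m f" "i < m" "j < m"
  shows "f i j < m" "f i j = f j i" "\<exists>x<m. f i x = j"
  using assms unfolding comm_quasigroup_def by blast+

text \<open>There is one triple for each level and each pair \<open>i < j\<close>. The upper bound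
  suffices for \<open>covering_imp_packing\<close>, so possible coincidences between triples need no
  discussion.\<close>

lemma card_qblocks: "card (qblocks m f) \<le> 3 * (m choose 2)"
proof -
  have "card (SIGMA j:{..<m}. {..<j}) = m choose 2"
  proof (induction m)
    case (Suc m)
    then show ?case
      by (simp add: numeral_2_eq_2)
  qed simp
  then have "3 * (m choose 2) = card ((SIGMA j:{..<m}. {..<j}) \<times> {..<3::nat})"
    by (simp add: card_cartesian_product)
  also have "card (qblocks m f) \<le> \<dots>"
    unfolding qblocks_def by (rule card_image_le) simp
  finally show ?thesis .
qed

lemma qblocks_triples:
  assumes "\<And>t. t < 3 \<Longrightarrow> comm_quasigroup m (f t)" "B \<in> qblocks m f"
  shows "B \<subseteq> {..<3 * m}" "card B = 3"
proof -
  obtain i j t where B: "B = {pt i t, pt j t, pt (f t i j) (Suc t mod 3)}" "i < j" "j < m" "t < 3"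
    using assms(2) by (auto simp: qblocks_def)
  then have "f t i j < m"
    using comm_quasigroupD(1)[OF assms(1)] by simp
  then show "B \<subseteq> {..<3 * m}"
    using B by (auto simp: pt_less)
  have "Suc t mod 3 \<noteq> t"
    by presburger
  then show "card B = 3"
    using B by (auto simp: pt_eq_iff card_insert_if)
qed

lemma qblocks_level:
  assumes "comm_quasigroup m (f t)" "i < m" "j < m" "i \<noteq> j" "t < 3"
  shows "{pt i t, pt j t, pt (f t i j) (Suc t mod 3)} \<in> qblocks m f"
proof -
  have *: "{pt a t, pt b t, pt (f t a b) (Suc t mod 3)} \<in> qblocks m f" if "a < b" "b < m" for a b
    unfolding qblocks_def using that assms by (intro image_eqI[where x = "((b, a), t)"]) auto
  show ?thesis
  proof (cases "i < j")
    case True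
    show ?thesis
      by (rule *[OF True assms(3)])
  next
    case False
    then have "{pt j t, pt i t, pt (f t j i) (Suc t mod 3)} \<in> qblocks m f"
      using assms(2,4) by (intro *) simp_all
    moreover have "f t j i = f t i j"
      using assms by (intro comm_quasigroupD(2))
    ultimately show ?thesis
      by (simp only: insert_commute)
  qed
qed

text \<open>Solving \<open>f t i x = j\<close> gives the triple; the solution differs from
  \<open>i\<close> exactly because the diagonal value \<open>f t i i\<close> is excluded.\<close>

lemma qblocks_mixed:
  assumes "comm_quasigroup m (f t)" "i < m" "j < m" "j \<noteq> f t i i" "t < 3"
  shows "\<exists>B\<in>qblocks m f. {pt i t, pt j (Suc t mod 3)} \<subseteq> B"
proof -
  obtain x where x: "x < m" "f t i x = j"
    using comm_quasigroupD(3)[of m "f t" i j] assms by blast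
  have "i \<noteq> x"
    using x(2) assms(4) by blast
  then have "{pt i t, pt x t, pt j (Suc t mod 3)} \<in> qblocks m f"
    using qblocks_level[of m f t i x] assms x by simp
  then show ?thesis
    by (rule bexI[rotated]) simp
qed

lemma mod_3_cases:
  assumes "s < 3" "t < (3::nat)" "s \<noteq> t"
  shows "s = Suc t mod 3 \<or> t = Suc s mod 3"
proof -
  have "s = 0 \<or> s = 1 \<or> s = 2" "t = 0 \<or> t = 1 \<or> t = 2"
    using assms by auto
  then show ?thesis
    using assms(3) by auto
qed

text \<open>Points on one level share a triple of \<open>qblocks\<close>, and two distinct levels
  are always cyclically consecutive. So the additional blocks \<open>E\<close> only have to deal
  with the diagonal pairs outside \<open>L\<close>.\<close>

lemma cover_finite_points:
  assumes Q: "\<And>t. t < 3 \<Longrightarrow> comm_quasigroup m (f t)"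
    and diag: "\<And>i t. i < m \<Longrightarrow> t < 3 \<Longrightarrow> {pt i t, pt (f t i i) (Suc t mod 3)} \<notin> L \<Longrightarrow>
      \<exists>B\<in>E. {pt i t, pt (f t i i) (Suc t mod 3)} \<subseteq> B"
    and xy: "x < 3 * m" "y < 3 * m" "x \<noteq> y" "{x, y} \<notin> L"
  shows "\<exists>B\<in>qblocks m f \<union> E. {x, y} \<subseteq> B"
proof -
  have mixed: "\<exists>B\<in>qblocks m f \<union> E. {pt i t, pt j (Suc t mod 3)} \<subseteq> B"
    if "i < m" "j < m" "t < 3" "{pt i t, pt j (Suc t mod 3)} \<notin> L" for i j t
  proof (cases "j = f t i i")
    case True
    then have "\<exists>B\<in>E. {pt i t, pt j (Suc t mod 3)} \<subseteq> B"
      using diag[of i t] that by simp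
    then show ?thesis
      by blast
  next
    case False
    then have "\<exists>B\<in>qblocks m f. {pt i t, pt j (Suc t mod 3)} \<subseteq> B"
      using qblocks_mixed[of m f t i j] Q that by simp
    then show ?thesis
      by blast
  qed
  obtain i s where x: "x = pt i s" "i < m" "s < 3"
    using xy ptE by metis
  obtain j t where y: "y = pt j t" "j < m" "t < 3"
    using xy ptE by metis
  show ?thesis
  proof (cases "s = t")
    case True
    then have "{pt i t, pt j t, pt (f t i j) (Suc t mod 3)} \<in> qblocks m f"
      using qblocks_level[of m f t i j] Q[of t] x y xy by blast
    then show ?thesis
      using True x y by blast
  next
    case False
    then consider "s = Suc t mod 3" | "t = Suc s mod 3"
      using mod_3_cases x y by blast
    then show ?thesis
    proof cases
      case 1
      then show ?thesis
        using mixed[of j i t] x y xy by (simp add: insert_commute)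
    next
      case 2
      then show ?thesis
        using mixed[of i j s] x y xy by simp
    qed
  qed
qed

section \<open>Commutative quasigroups of odd and even order\<close>

text \<open>Multiplication by \<open>k + 1\<close> halves modulo \<open>2 * k + 1\<close>.\<close>

definition mean :: "nat \<Rightarrow> nat \<Rightarrow> nat \<Rightarrow> nat" where
  "mean k i j = ((k + 1) * (i + j)) mod (2 * k + 1)"

lemma mean_self: "i < 2 * k + 1 \<Longrightarrow> mean k i i = i"
proof -
  assume "i < 2 * k + 1"
  moreover have "(k + 1) * (i + i) = i + i * (2 * k + 1)"
    by (simp add: algebra_simps)
  ultimately show ?thesis
    unfolding mean_def by (simp only: mod_mult_self1 mod_less)
qed

lemma comm_quasigroup_mean: "comm_quasigroup (2 * k + 1) (mean k)"
  unfolding comm_quasigroup_def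
proof (intro allI impI conjI)
  fix i j
  assume ij: "i < 2 * k + 1" "j < 2 * k + 1"
  show "mean k i j < 2 * k + 1" "mean k i j = mean k j i"
    by (simp_all add: mean_def add.commute)
  let ?m = "2 * k + 1"
  \<comment> \<open>The solution \<open>2 * j - i\<close> of \<open>(i + x) / 2 = j\<close>, with
    \<open>?m\<close> added to keep the subtraction from truncating.\<close>
  let ?x = "(2 * j + (?m - i)) mod ?m"
  have "mean k i ?x = ((k + 1) * (i + (2 * j + (?m - i)))) mod ?m"
    unfolding mean_def by (metis mod_add_right_eq mod_mult_right_eq)
  also have "(k + 1) * (i + (2 * j + (?m - i))) = (k + 1) * (2 * j + ?m)"
    using ij by simp
  also have "\<dots> = j + (j + k + 1) * ?m"
    by (simp add: algebra_simps)
  also have "\<dots> mod ?m = j"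
    using ij by (simp only: mod_mult_self1 mod_less)
  finally show "\<exists>x<?m. mean k i x = j"
    by (intro exI[of _ ?x]) simp
qed

text \<open>The outer \<open>mod\<close> matters only for \<open>i = 0\<close>, which becomes a
  fixed point.\<close>

definition neg_mod :: "nat \<Rightarrow> nat \<Rightarrow> nat" where
  "neg_mod m i = (m - i) mod m"

lemma neg_mod_less: "i < m \<Longrightarrow> neg_mod m i < m"
  by (simp add: neg_mod_def)

lemma neg_mod_neg_mod: "i < m \<Longrightarrow> neg_mod m (neg_mod m i) = i"
  by (cases "i = 0") (auto simp: neg_mod_def)

text \<open>Composing the operation with a permutation keeps it commutative and its equations
  solvable.\<close>

lemma comm_quasigroup_neg:
  assumes "comm_quasigroup m f"
  shows "comm_quasigroup m (\<lambda>i j. neg_mod m (f i j))"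
  using assms unfolding comm_quasigroup_def by (metis neg_mod_less neg_mod_neg_mod)

text \<open>The addition table of the integers modulo \<open>2 * k\<close> with its values renamed:
  \<open>2 * r\<close> becomes \<open>r\<close> and \<open>2 * r + 1\<close> becomes
  \<open>r + k\<close>.\<close>

definition half_idem :: "nat \<Rightarrow> nat \<Rightarrow> nat \<Rightarrow> nat" where
  "half_idem k i j =
     (let s = (i + j) mod (2 * k) in if even s then s div 2 else s div 2 + k)"

lemma half_idem_self:
  assumes "i < k"
  shows "half_idem k i i = i" "half_idem k (i + k) (i + k) = i"
proof -
  have "(i + i) mod (2 * k) = 2 * i"
    using assms by simp
  moreover have "i + k + (i + k) = i + i + 2 * k"
    by simp
  then have "(i + k + (i + k)) mod (2 * k) = (i + i) mod (2 * k)"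
    by (simp only: mod_add_self2)
  ultimately show "half_idem k i i = i" "half_idem k (i + k) (i + k) = i"
    using assms by (simp_all add: half_idem_def)
qed

lemma comm_quasigroup_half_idem: "comm_quasigroup (2 * k) (half_idem k)"
  unfolding comm_quasigroup_def
proof (intro allI impI conjI)
  fix i j
  assume ij: "i < 2 * k" "j < 2 * k"
  have "(i + j) mod (2 * k) < 2 * k"
    using ij by auto
  then show "half_idem k i j < 2 * k"
    by (auto simp: half_idem_def Let_def)
  show "half_idem k i j = half_idem k j i"
    by (simp add: half_idem_def add.commute)
  \<comment> \<open>The residue that is renamed to \<open>j\<close>; the equation then reduces to
    \<open>i + x = s\<close> modulo \<open>2 * k\<close>.\<close>
  define s where "s = (if j < k then 2 * j else 2 * (j - k) + 1)"
  have s: "s < 2 * k"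
    using ij by (auto simp: s_def)
  let ?x = "(s + (2 * k - i)) mod (2 * k)"
  have "(i + ?x) mod (2 * k) = (i + (s + (2 * k - i))) mod (2 * k)"
    by (simp add: mod_add_right_eq)
  also have "\<dots> = s"
    using ij s by simp
  finally have "half_idem k i ?x = j"
    using ij by (auto simp: half_idem_def s_def)
  then show "\<exists>x<2 * k. half_idem k i x = j"
    using ij by (intro exI[of _ ?x]) auto
qed

section \<open>Triple systems of orders 6k + 3, 6k + 1 and 6k + 5\<close>

text \<open>
  Bose's construction: \<open>mean k\<close> is idempotent, so the pairs missed by \<open>qblocks\<close> form triangles.
\<close>

lemma Steiner_6k3:
  "\<exists>A. is_packing (6 * k + 3) 3 {..<6 * k + 3} A \<and> leave_edges {..<6 * k + 3} A = {}"
proof -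
  define m where "m = 2 * k + 1"
  define E where "E = (\<lambda>i. {pt i 0, pt i 1, pt i 2}) ` {..<m}"
  let ?f = "\<lambda>_ :: nat. mean k"
  let ?A = "qblocks m ?f \<union> E"
  have m: "6 * k + 3 = 3 * m"
    by (simp add: m_def)
  have Q: "comm_quasigroup m (?f t)" for t
    using comm_quasigroup_mean by (simp add: m_def)
  have "is_packing (6 * k + 3) 3 {..<6 * k + 3} ?A \<and> leave_edges {..<6 * k + 3} ?A = {}"
  proof (rule covering_imp_packing)
    fix B
    assume "B \<in> ?A"
    then show "B \<subseteq> {..<6 * k + 3} \<and> card B = 3"
      unfolding m using qblocks_triples[of m ?f B] Q
      by (auto simp: E_def pt_less pt_eq_iff card_insert_if)
  next
    fix x y
    assume xy: "x \<in> {..<6 * k + 3}" "y \<in> {..<6 * k + 3}" "x \<noteq> y"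
    have "\<exists>B\<in>E. {pt i t, pt (mean k i i) (Suc t mod 3)} \<subseteq> B" if "i < m" "t < 3" for i t
    proof -
      have "t = 0 \<or> t = 1 \<or> t = 2"
        using that by auto
      then have "{pt i t, pt (mean k i i) (Suc t mod 3)} \<subseteq> {pt i 0, pt i 1, pt i 2}"
        using that by (auto simp: mean_self m_def numeral_2_eq_2)
      then show ?thesis
        unfolding E_def using that by blast
    qed
    then show "\<exists>B\<in>?A. {x, y} \<subseteq> B"
      using cover_finite_points[of m ?f "{}" E x y] Q xy m by auto
  next
    \<comment> \<open>The total is the number of blocks of a Steiner triple system of order 6k + 3,
      so \<open>covering_imp_packing\<close> applies with equality.\<close>
    have "card E \<le> m"
      unfolding E_def using card_image_le[of "{..<m}"] by fastforce
    then have "card ?A \<le> 3 * (m choose 2) + m"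
      using card_Un_le[of "qblocks m ?f" E] card_qblocks[of m ?f] by linarith
    also have "3 * (m choose 2) + m = 6 * k^2 + 5 * k + 1"
      by (simp add: m_def choose_two algebra_simps power2_eq_square)
    finally show "3 * card ?A + card {} \<le> (6 * k + 3) choose 2"
      by (simp add: choose_two_mod_6)
  qed auto
  then show ?thesis
    by blast
qed

text \<open>
  Skolem's construction: \<open>half_idem k\<close> maps both \<open>(i, i)\<close> and \<open>(i + k, i + k)\<close> to \<open>i\<close>, so
  the missed pairs form triangles on the lower half, and each point \<open>(i + k, t)\<close> is missed with
  \<open>(i, t + 1)\<close>.
\<close>

lemma Steiner_6k1:
  "\<exists>A. is_packing (6 * k + 1) 3 {..<6 * k + 1} A \<and> leave_edges {..<6 * k + 1} A = {}"
proof -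
  define m where "m = 2 * k"
  define E1 where "E1 = (\<lambda>i. {pt i 0, pt i 1, pt i 2}) ` {..<k}"
  define E2 where "E2 = (\<lambda>(i, t). {3 * m, pt (i + k) t, pt i (Suc t mod 3)}) ` ({..<k} \<times> {..<3})"
  let ?f = "\<lambda>_ :: nat. half_idem k"
  let ?A = "qblocks m ?f \<union> (E1 \<union> E2)"
  have m: "6 * k + 1 = Suc (3 * m)"
    by (simp add: m_def)
  have Q: "comm_quasigroup m (?f t)" for t
    using comm_quasigroup_half_idem by (simp add: m_def)
  have up: "Suc t mod 3 \<noteq> t" for t
    by presburger
  have E2I: "{3 * m, pt (i + k) t, pt i (Suc t mod 3)} \<in> E2" if "i < k" "t < 3" for i t
    unfolding E2_def using that by (intro image_eqI[where x = "(i, t)"]) auto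
  have inf: "\<exists>B\<in>E2. {3 * m, x} \<subseteq> B" if "x < 3 * m" for x
  proof -
    obtain i t where x: "x = pt i t" "i < m" "t < 3"
      using \<open>x < 3 * m\<close> by (rule ptE)
    show ?thesis
    proof (cases "i < k")
      case True
      \<comment> \<open>\<open>s\<close> is \<open>t - 1\<close> modulo 3: a point of the lower half
        is the last entry of the \<open>E2\<close> triple that starts one level earlier.\<close>
      define s where "s = (t + 2) mod 3"
      have "Suc s mod 3 = t" "s < 3"
        using x(3) unfolding s_def by presburger+
      then show ?thesis
        using E2I[of i s] x True by auto
    next
      case False
      then obtain a where "i = a + k" "a < k"
        using x by (intro that[of "i - k"]) (simp_all add: m_def)
      then show ?thesis
        using E2I[of a t] x by auto
    qed
  qed
  have "is_packing (6 * k + 1) 3 {..<6 * k + 1} ?A \<and> leave_edges {..<6 * k + 1} ?A = {}"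
  proof (rule covering_imp_packing)
    fix B
    assume "B \<in> ?A"
    then consider "B \<in> qblocks m ?f" | "B \<in> E1" | "B \<in> E2"
      by blast
    then show "B \<subseteq> {..<6 * k + 1} \<and> card B = 3"
    proof cases
      case 1
      then show ?thesis
        unfolding m using qblocks_triples[of m ?f B] Q by fastforce
    next
      case 2
      then obtain i where i: "i < k" "B = {pt i 0, pt i 1, pt i 2}"
        by (auto simp: E1_def)
      then show ?thesis
        by (auto simp: pt_def)
    next
      case 3
      then obtain i t where i: "i < k" "t < 3" "B = {3 * m, pt (i + k) t, pt i (Suc t mod 3)}"
        by (auto simp: E2_def)
      then have "i + k < m" "i < m"
        by (auto simp: m_def)
      then have "pt (i + k) t < 3 * m" "pt i (Suc t mod 3) < 3 * m"
        "pt (i + k) t \<noteq> pt i (Suc t mod 3)"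
        using i up[of t] by (auto simp: pt_less pt_eq_iff)
      then show ?thesis
        unfolding m i(3) by simp
    qed
  next
    fix x y
    assume xy: "x \<in> {..<6 * k + 1}" "y \<in> {..<6 * k + 1}" "x \<noteq> y"
    have diag: "\<exists>B\<in>E1 \<union> E2. {pt i t, pt (half_idem k i i) (Suc t mod 3)} \<subseteq> B"
      if "i < m" "t < 3" for i t
    proof (cases "i < k")
      case True
      have "t = 0 \<or> t = 1 \<or> t = 2"
        using that by auto
      then have "{pt i t, pt (half_idem k i i) (Suc t mod 3)} \<subseteq> {pt i 0, pt i 1, pt i 2}"
        using True by (auto simp: half_idem_self numeral_2_eq_2)
      then show ?thesis
        unfolding E1_def using True by blast
    next
      case False
      then obtain a where "i = a + k" "a < k"
        using \<open>i < m\<close> by (intro that[of "i - k"]) (simp_all add: m_def)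
      then show ?thesis
        using that(2) by (intro bexI[OF _ UnI2[OF E2I[of a t]]]) (simp_all add: half_idem_self)
    qed
    consider "x < 3 * m" "y < 3 * m" | "x = 3 * m" "y < 3 * m" | "y = 3 * m" "x < 3 * m"
      using xy unfolding m by fastforce
    then show "\<exists>B\<in>?A. {x, y} \<subseteq> B"
    proof cases
      case 1
      then show ?thesis
        using cover_finite_points[of m ?f "{}" "E1 \<union> E2" x y] Q diag xy by auto
    next
      case 2
      then show ?thesis
        using inf[of y] by auto
    next
      case 3
      then show ?thesis
        using inf[of x] by auto
    qed
  next
    have "card E1 \<le> k" "card E2 \<le> 3 * k"
      unfolding E1_def E2_def
      using card_image_le[of "{..<k}" "\<lambda>i. {pt i 0, pt i 1, pt i 2}"]
        card_image_le[of "{..<k} \<times> {..<3}" "\<lambda>(i, t). {3 * m, pt (i + k) t, pt i (Suc t mod 3)}"]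
      by (simp_all add: card_cartesian_product)
    then have "card ?A \<le> 3 * (m choose 2) + 4 * k"
      using card_Un_le[of "qblocks m ?f" "E1 \<union> E2"] card_Un_le[of E1 E2] card_qblocks[of m ?f]
      by linarith
    also have "3 * (m choose 2) = 3 * (k * (2 * k - 1))"
      by (simp add: m_def choose_two)
    \<comment> \<open>The case \<open>k = 0\<close> is separate because \<open>2 * k - 1\<close> is
      truncated there.\<close>
    also have "\<dots> + 4 * k = 6 * k^2 + k"
      by (cases k) (simp_all add: algebra_simps power2_eq_square)
    finally show "3 * card ?A + card {} \<le> (6 * k + 1) choose 2"
      by (simp only: choose_two_mod_6 card.empty)
  qed auto
  then show ?thesis
    by blast
qed

text \<open>
  As in Bose's construction, but the step from level 2 to level 0 is twisted by negation: the
  pairs left over are a triangle and 6-cycles, and the two extra points absorb the two perfect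
  matchings of each 6-cycle.
\<close>

lemma packing_6k5:
  "\<exists>A F. is_packing (6 * k + 5) 3 {..<6 * k + 5} A \<and> F \<subseteq> {..<6 * k + 5} \<and> card F = 5 \<and>
     leave_edges {..<6 * k + 5} A = two_subsets F"
proof -
  define m where "m = 2 * k + 1"
  define u where "u = 3 * m"
  define w where "w = 3 * m + 1"
  define f where "f t = (if t = 2 then (\<lambda>i j. neg_mod m (mean k i j)) else mean k)" for t :: nat
  \<comment> \<open>Index 0 is its own negative, so its diagonal pairs form a triangle. No block
    joins it to \<open>u\<close> or \<open>w\<close>, and \<open>{u, w}\<close> is uncovered too:
    the leave is a K5.\<close>
  define F where "F = {pt 0 0, pt 0 1, pt 0 2, u, w}"
  \<comment> \<open>The 6-cycle runs through levels 0, 1, 2 at \<open>i\<close>, then levels 0, 1, 2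
    at \<open>m - i\<close>, and back. Its edges go alternately to \<open>u\<close> and
    \<open>w\<close>.\<close>
  define six where "six i = set
    [{u, pt i 0, pt i 1}, {u, pt i 2, pt (m - i) 0}, {u, pt (m - i) 1, pt (m - i) 2},
     {w, pt i 1, pt i 2}, {w, pt (m - i) 0, pt (m - i) 1}, {w, pt (m - i) 2, pt i 0}]" for i
  \<comment> \<open>The nonzero indices below \<open>m = 2 * k + 1\<close> form \<open>k\<close>
    pairs \<open>i\<close>, \<open>m - i\<close>; each pair gives one cycle.\<close>
  define E where "E = (\<Union>i\<in>{1..k}. six i)"
  let ?n = "6 * k + 5"
  let ?A = "qblocks m f \<union> E"
  have n: "{..<?n} = insert u (insert w {..<3 * m})" and m: "?n = 3 * m + 2"
    by (auto simp: m_def u_def w_def)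
  have Q: "comm_quasigroup m (f t)" for t
    using comm_quasigroup_mean comm_quasigroup_neg by (simp add: m_def f_def)
  have F: "F \<subseteq> {..<?n}" "card F = 5"
    by (auto simp: F_def u_def w_def m_def pt_def)
  have half: "i \<in> {1..k} \<or> (\<exists>j\<in>{1..k}. i = m - j)" if "i < m" "i \<noteq> 0" for i
  proof (cases "i \<le> k")
    case False
    then have "m - i \<in> {1..k}" "i = m - (m - i)"
      using that by (auto simp: m_def)
    then show ?thesis
      by blast
  qed (use that in auto)
  have three: "t = 0 \<or> t = 1 \<or> t = 2" if "t < 3" for t :: nat
    using that by auto
  have inf: "\<exists>B\<in>E. {u, pt i t} \<subseteq> B" "\<exists>B\<in>E. {w, pt i t} \<subseteq> B"
    if it: "i < m" "i \<noteq> 0" "t < 3" for i t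
  proof -
    obtain j where j: "j \<in> {1..k}" "i = j \<or> i = m - j"
      using half it by blast
    then have "\<exists>B\<in>six j. {u, pt i t} \<subseteq> B" "\<exists>B\<in>six j. {w, pt i t} \<subseteq> B"
      using three[OF it(3)] by (auto simp: six_def)
    then show "\<exists>B\<in>E. {u, pt i t} \<subseteq> B" "\<exists>B\<in>E. {w, pt i t} \<subseteq> B"
      using j by (auto simp: E_def)
  qed
  have "is_packing ?n 3 {..<?n} ?A \<and> leave_edges {..<?n} ?A = two_subsets F"
  proof (rule covering_imp_packing)
    fix B
    assume "B \<in> ?A"
    then consider "B \<in> qblocks m f" | i where "i \<in> {1..k}" "B \<in> six i"
      by (auto simp: E_def)
    then show "B \<subseteq> {..<?n} \<and> card B = 3"
    proof cases
      case 1
      then show ?thesis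
        unfolding m using qblocks_triples[of m f B] Q by fastforce
    next
      case 2
      then have i: "i < m" "m - i < m" "i \<noteq> m - i"
        by (auto simp: m_def)
      have "pt j t < 3 * m" if "j < m" "t < 3" for j t
        using that by (simp add: pt_less)
      then have "pt j t < 3 * m" "u \<noteq> pt j t" "w \<noteq> pt j t" if "j < m" "t < 3" for j t
        using that by (fastforce simp: u_def w_def)+
      then show ?thesis
        unfolding n using 2 i by (auto simp: six_def pt_eq_iff card_insert_if)
    qed
  next
    fix x y
    assume xy: "x \<in> {..<?n}" "y \<in> {..<?n}" "x \<noteq> y" "{x, y} \<notin> two_subsets F"
    have diag: "\<exists>B\<in>E. {pt i t, pt (f t i i) (Suc t mod 3)} \<subseteq> B"
      if it: "i < m" "t < 3" "{pt i t, pt (f t i i) (Suc t mod 3)} \<notin> two_subsets F" for i t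
    proof -
      have f: "f t i i = (if t = 2 then neg_mod m i else i)"
        using it(1) by (simp add: f_def mean_self m_def)
      \<comment> \<open>The diagonal pairs at index 0 lie inside \<open>F\<close>, hence in the
        intended leave.\<close>
      have "i \<noteq> 0"
      proof
        assume "i = 0"
        then show False
          using it(3) three[OF it(2)] f
          by (auto simp: F_def doubleton_in_two_subsets neg_mod_def pt_eq_iff)
      qed
      then obtain j where j: "j \<in> {1..k}" "i = j \<or> i = m - j"
        using half it by blast
      define z where "z = f t i i"
      have z: "z = (if t = 2 then m - i else i)"
        using f it(1) \<open>i \<noteq> 0\<close> by (simp add: z_def neg_mod_def)
      \<comment> \<open>Gives \<open>m - (m - j) = j\<close>, so that the twisted edge at
        \<open>m - j\<close> closes the cycle at \<open>pt j 0\<close>.\<close>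
      have "j \<le> m"
        using j(1) by (simp add: m_def)
      then have "\<exists>B\<in>six j. {pt i t, pt (f t i i) (Suc t mod 3)} \<subseteq> B"
        unfolding z_def[symmetric] using three[OF it(2)] j(2)
        by (elim disjE) (simp_all add: z six_def numeral_2_eq_2)
      then show ?thesis
        using j by (auto simp: E_def)
    qed
    have inf': "\<exists>B\<in>?A. {v, z} \<subseteq> B" if "v \<in> {u, w}" "z < 3 * m" "{v, z} \<notin> two_subsets F" for v z
    proof -
      obtain i t where z: "z = pt i t" "i < m" "t < 3"
        using \<open>z < 3 * m\<close> by (rule ptE)
      have "i \<noteq> 0"
      proof
        assume "i = 0"
        then have "z \<in> F"
          using three[OF z(3)] z by (auto simp: F_def)
        moreover have "v \<in> F" "v \<noteq> z"
          using that by (auto simp: F_def u_def w_def)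
        ultimately show False
          using that by (simp add: doubleton_in_two_subsets)
      qed
      then show ?thesis
        using inf[of i t] z that(1) by blast
    qed
    have "{u, w} \<in> two_subsets F"
      by (simp add: doubleton_in_two_subsets F_def u_def w_def)
    then consider "x < 3 * m" "y < 3 * m" | "x \<in> {u, w}" "y < 3 * m" | "y \<in> {u, w}" "x < 3 * m"
      using xy unfolding n by (auto simp: insert_commute)
    then show "\<exists>B\<in>?A. {x, y} \<subseteq> B"
    proof cases
      case 1
      then show ?thesis
        using cover_finite_points[of m f "two_subsets F" E x y] Q diag xy by blast
    next
      case 2
      then show ?thesis
        using inf'[of x y] xy by auto
    next
      case 3
      then show ?thesis
        using inf'[of y x] xy by (auto simp: insert_commute)
    qed
  next
    show "two_subsets F \<subseteq> two_subsets {..<?n}"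
      using F by (auto simp: two_subsets_def)
    have six: "card (six i) \<le> 6" for i
      unfolding six_def by (rule order.trans[OF card_length]) simp
    have "card E \<le> (\<Sum>i\<in>{1..k}. card (six i))"
      unfolding E_def by (rule card_UN_le) simp
    also have "\<dots> \<le> 6 * k"
      using sum_mono[of "{1..k}" "\<lambda>i. card (six i)" "\<lambda>_. 6"] six by simp
    finally have "card ?A \<le> 3 * (m choose 2) + 6 * k"
      using card_Un_le[of "qblocks m f" E] card_qblocks[of m f] by linarith
    also have "3 * (m choose 2) + 6 * k = 6 * k^2 + 9 * k"
      by (simp add: m_def choose_two algebra_simps power2_eq_square)
    finally have "card ?A \<le> 6 * k^2 + 9 * k" .
    moreover have "card (two_subsets F) = 10"
      using F by (simp add: card_two_subsets choose_two card_ge_0_finite)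
    ultimately show "3 * card ?A + card (two_subsets F) \<le> ?n choose 2"
      by (simp add: choose_two_mod_6)
  qed auto
  then show ?thesis
    using F by blast
qed

subsection \<open>Placing the subgraph in the leave\<close>

lemma packing_unique_block:
  assumes P: "is_packing n k X A" and "B \<in> A" "B' \<in> A" "x \<noteq> y" "{x, y} \<subseteq> B" "{x, y} \<subseteq> B'"
  shows "B = B'"
proof -
  have "finite {C \<in> A. {x, y} \<subseteq> C}"
    using P finite_blocks[of X A] by (auto simp: is_packing_def)
  moreover have "{x, y} \<in> two_subsets X"
    using assms by (auto simp: doubleton_in_two_subsets is_packing_def)
  then have "card {C \<in> A. {x, y} \<subseteq> C} \<le> Suc 0"
    using P by (auto simp: is_packing_def)
  moreover have "B \<in> {C \<in> A. {x, y} \<subseteq> C}" "B' \<in> {C \<in> A. {x, y} \<subseteq> C}"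
    using assms by simp_all
  ultimately show ?thesis
    by (metis (no_types, lifting) card_le_Suc0_iff_eq)
qed

text \<open>\<open>B\<close> is the only block of \<open>A\<close> containing the pair, so dropping
  \<open>B\<close> uncovers it. The separate point set \<open>X'\<close> allows for a deleted
  point.\<close>

lemma leave_edgeI:
  assumes P: "is_packing n k X A" and "A' \<subseteq> A" "B \<in> A" "B \<notin> A'"
    and "x \<in> B" "y \<in> B" "x \<in> X'" "y \<in> X'" "x \<noteq> y"
  shows "{x, y} \<in> leave_edges X' A'"
proof -
  have "\<not> {x, y} \<subseteq> C" if "C \<in> A'" for C
    using packing_unique_block[OF P, of B C x y] that assms by blast
  then show ?thesis
    using assms by (simp add: leave_edges_eq doubleton_in_two_subsets)
qed

lemma Steiner_block:
  assumes P: "is_packing n 3 X A" and L: "leave_edges X A = {}"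
    and xy: "x \<in> X" "y \<in> X" "x \<noteq> y"
  obtains z where "{x, y, z} \<in> A" "z \<in> X" "z \<noteq> x" "z \<noteq> y"
proof -
  have "{x, y} \<notin> leave_edges X A"
    using L by blast
  then obtain B where B: "B \<in> A" "{x, y} \<subseteq> B"
    using xy by (auto simp: leave_edges_eq doubleton_in_two_subsets)
  then have BX: "B \<subseteq> X" "card B = 3"
    using P by (auto simp: is_packing_def)
  then have "card (B - {x, y}) = 1"
    using B xy by (simp add: card_Diff_subset)
  then obtain z where "B - {x, y} = {z}"
    by (auto simp: card_1_singleton_iff)
  then have "B = {x, y, z}" "z \<noteq> x" "z \<noteq> y"
    using B(2) by blast+
  then show ?thesis
    using that B BX by blast
qed

lemma packing_subset:
  assumes P: "is_packing n k X A" and "A' \<subseteq> A"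
  shows "is_packing n k X A'"
proof -
  have "finite A"
    using P finite_blocks[of X A] by (auto simp: is_packing_def)
  then have "card {B \<in> A'. e \<subseteq> B} \<le> card {B \<in> A. e \<subseteq> B}" for e
    using assms(2) by (intro card_mono) auto
  then show ?thesis
    using assms unfolding is_packing_def by (meson order.trans subsetD)
qed

lemma packing_delete_point:
  assumes P: "is_packing (Suc n) k X A" and p: "p \<in> X"
  shows "is_packing n k (X - {p}) {B \<in> A. p \<notin> B}"
proof -
  have "is_packing (Suc n) k X {B \<in> A. p \<notin> B}"
    using P by (rule packing_subset) blast
  moreover have "two_subsets (X - {p}) \<subseteq> two_subsets X"
    by (auto simp: two_subsets_def)
  ultimately show ?thesis
    using p by (fastforce simp: is_packing_def)
qed

lemma ex_point_notin:
  assumes "finite S" "card S < card X"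
  obtains x where "x \<in> X" "x \<notin> S"
  using assms by (meson card_mono linorder_not_le subsetI)

section \<open>Copies of K4 - e obtained from Steiner triple systems\<close>

lemma Steiner_remove_blocks:
  assumes P: "is_packing n 3 X A" and L: "leave_edges X A = {}" and n: "4 \<le> n"
  shows "\<exists>A'. is_packing n 3 X A' \<and> contains_copy (leave X A') K4_minus_e \<and>
    card A \<le> card A' + 3"
proof -
  have X: "finite X" "card X = n"
    using P by (auto simp: is_packing_def)
  obtain c where c: "c \<in> X"
    using ex_point_notin[of "{}" X] X n by auto
  obtain d where d: "d \<in> X" "d \<noteq> c"
    using ex_point_notin[of "{c}" X] X n by auto
  obtain a where a: "{c, d, a} \<in> A" "a \<in> X" "a \<noteq> c" "a \<noteq> d"
    using Steiner_block[OF P L c d(1)] d(2) by metis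
  have "card {c, d, a} = 3"
    using a d by simp
  then obtain b where b: "b \<in> X" "b \<notin> {c, d, a}"
    using ex_point_notin[of "{c, d, a}" X] X n by auto
  obtain x where x: "{b, c, x} \<in> A"
    using Steiner_block[OF P L b(1) c] b(2) by blast
  obtain y where y: "{b, d, y} \<in> A"
    using Steiner_block[OF P L b(1) d(1)] b(2) by blast
  \<comment> \<open>The first block releases \<open>{c, d}\<close>, \<open>{a, c}\<close>,
    \<open>{a, d}\<close>; the other two release \<open>{b, c}\<close> and
    \<open>{b, d}\<close>.\<close>
  define R where "R = {{c, d, a}, {b, c, x}, {b, d, y}}"
  have edge: "{u, v} \<in> leave_edges X (A - R)"
    if "B \<in> A" "B \<in> R" "u \<in> B" "v \<in> B" "u \<in> X" "v \<in> X" "u \<noteq> v" for B u v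
    using that by (intro leave_edgeI[OF P, of _ B]) auto
  have "{{a, c}, {a, d}, {b, c}, {b, d}, {c, d}} \<subseteq> leave_edges X (A - R)"
    using edge[OF a(1)] edge[OF x] edge[OF y] a b c d by (simp add: R_def)
  moreover have "distinct [a, b, c, d]"
    using a b d by auto
  ultimately have "contains_copy (leave X (A - R)) K4_minus_e"
    unfolding contains_copy_K4_minus_e[OF X(1)] by blast
  moreover have "card A \<le> card (A - R) + 3"
  proof -
    have "card R \<le> 3"
      by (simp add: R_def card_insert_if)
    moreover have "card A - card R \<le> card (A - R)"
      by (rule diff_card_le_card_Diff) (simp add: R_def)
    ultimately show ?thesis
      by linarith
  qed
  ultimately show ?thesis
    using packing_subset[OF P, of "A - R"] by blast
qed

text \<open>Deleting \<open>p\<close> destroys the n/2 blocks through it, among them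
  \<open>{p, b, d}\<close>, which releases \<open>{b, d}\<close>. At most two further blocks are
  removed for the other four edges. The inequality is doubled to avoid halves.\<close>

lemma Steiner_delete_point:
  fixes X :: "'a set"
  assumes P: "is_packing (Suc n) 3 X A" and L: "leave_edges X A = {}" and n: "3 \<le> n"
  shows "\<exists>(X' :: 'a set) A'. is_packing n 3 X' A' \<and> contains_copy (leave X' A') K4_minus_e \<and>
    2 * card A \<le> 2 * card A' + 4 + n"
proof -
  have X: "finite X" "card X = Suc n" "finite A"
    using P finite_blocks[of X A] by (auto simp: is_packing_def)
  obtain p where p: "p \<in> X"
    using ex_point_notin[of "{}" X] X by auto
  obtain b where b: "b \<in> X" "b \<noteq> p"
    using ex_point_notin[of "{p}" X] X n by auto
  obtain d where d: "{p, b, d} \<in> A" "d \<in> X" "d \<noteq> p" "d \<noteq> b"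
    using Steiner_block[OF P L p b(1)] b(2) by metis
  have "card {p, b, d} = 3"
    using b d by simp
  then obtain c where c: "c \<in> X" "c \<notin> {p, b, d}"
    using ex_point_notin[of "{p, b, d}" X] X n by auto
  obtain x where x: "{b, c, x} \<in> A"
    using Steiner_block[OF P L b(1) c(1)] c(2) by blast
  obtain a where a: "{c, d, a} \<in> A" "a \<in> X" "a \<noteq> c" "a \<noteq> d"
    using Steiner_block[OF P L c(1) d(2)] c(2) by blast
  have "b \<noteq> c"
    using c(2) by blast
  \<comment> \<open>Distinct blocks share at most one point; \<open>a = b\<close> or
    \<open>a = p\<close> would give these two blocks a second common point besides
    \<open>d\<close>.\<close>
  have ne: "{p, b, d} \<noteq> {c, d, a}"
    using c(2) by blast
  have "a \<noteq> b"
    using packing_unique_block[OF P d(1) a(1), of b d] ne d(4) by blast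
  have "a \<noteq> p"
    using packing_unique_block[OF P d(1) a(1), of p d] ne d(3) by blast
  define R where "R = {{b, c, x}, {c, d, a}}"
  define A' where "A' = {B \<in> A. p \<notin> B} - R"
  let ?X = "X - {p}"
  have edge: "{u, v} \<in> leave_edges ?X A'"
    if "B \<in> A" "B \<in> R \<or> p \<in> B" "u \<in> B" "v \<in> B" "u \<in> ?X" "v \<in> ?X" "u \<noteq> v" for B u v
    using that by (intro leave_edgeI[OF P, of _ B]) (auto simp: A'_def)
  have "{{a, c}, {a, d}, {b, c}, {b, d}, {c, d}} \<subseteq> leave_edges ?X A'"
    using edge[OF a(1)] edge[OF x] edge[OF d(1)] a b c d \<open>a \<noteq> p\<close> \<open>b \<noteq> c\<close> by (simp add: R_def)
  moreover have "distinct [a, b, c, d]"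
    using a \<open>a \<noteq> b\<close> c d by auto
  moreover have "finite ?X"
    using X by simp
  ultimately have "contains_copy (leave ?X A') K4_minus_e"
    unfolding contains_copy_K4_minus_e[OF \<open>finite ?X\<close>] by blast
  moreover have "is_packing n 3 ?X A'"
    using packing_subset[OF packing_delete_point[OF P p]] by (simp add: A'_def)
  moreover have "2 * card A \<le> 2 * card A' + 4 + n"
  proof -
    have "card R \<le> 2"
      by (simp add: R_def card_insert_if)
    moreover have "card {B \<in> A. p \<notin> B} - card R \<le> card A'"
      unfolding A'_def by (rule diff_card_le_card_Diff) (simp add: R_def)
    moreover have "card A = card {B \<in> A. p \<in> B} + card {B \<in> A. p \<notin> B}"
      using X by (subst card_Un_disjoint[symmetric]) (auto intro: arg_cong[where f = card])
    moreover have "2 * card {B \<in> A. p \<in> B} = n"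
      using packing_degree[OF P p] L by simp
    ultimately show ?thesis
      by linarith
  qed
  ultimately show ?thesis
    by blast
qed

section \<open>Copies of K4 - e obtained from packings with leave K5\<close>

lemma card_5E:
  assumes "card F = 5"
  obtains p a b c d where "F = {p, a, b, c, d}" "distinct [a, b, c, d]" "p \<notin> {a, b, c, d}"
proof -
  have "finite F"
    using assms by (simp add: card_ge_0_finite)
  then obtain xs where "set xs = F" "length xs = 5" "distinct xs"
    using finite_distinct_list assms distinct_card by metis
  then show ?thesis
    using that by (auto simp: numeral_eq_Suc length_Suc_conv)
qed

text \<open>The other four points of the K5 still span a K4. Since \<open>p\<close> has degree 4 in
  the leave, only (n - 4)/2 blocks pass through it.\<close>

lemma clique_delete_point:
  fixes X :: "'a set"
  assumes P: "is_packing (Suc n) 3 X A" and F: "F \<subseteq> X" "card F = 5"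
    and L: "leave_edges X A = two_subsets F"
  shows "\<exists>(X' :: 'a set) A'. is_packing n 3 X' A' \<and> contains_copy (leave X' A') K4_minus_e \<and>
    2 * card A + 4 \<le> 2 * card A' + n"
proof -
  have X: "finite X" "finite A" "finite F"
    using P F finite_blocks[of X A] finite_subset by (auto simp: is_packing_def)
  obtain p a b c d where abcd: "F = {p, a, b, c, d}" "distinct [a, b, c, d]" "p \<notin> {a, b, c, d}"
    using F(2) by (rule card_5E)
  have p: "p \<in> X"
    using F abcd by blast
  let ?X = "X - {p}"
  let ?A = "{B \<in> A. p \<notin> B}"
  have "finite ?X"
    using X by simp
  have edge: "{x, y} \<in> leave_edges ?X ?A" if "x \<in> F" "y \<in> F" "x \<noteq> y" "x \<noteq> p" "y \<noteq> p" for x y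
  proof -
    have "{x, y} \<in> leave_edges X A"
      using that L by (simp add: doubleton_in_two_subsets)
    then show ?thesis
      using that by (auto simp: leave_edges_eq doubleton_in_two_subsets)
  qed
  have "{{a, c}, {a, d}, {b, c}, {b, d}, {c, d}} \<subseteq> leave_edges ?X ?A"
    using abcd by (auto intro!: edge)
  then have "contains_copy (leave ?X ?A) K4_minus_e"
    unfolding contains_copy_K4_minus_e[OF \<open>finite ?X\<close>] using abcd(2) by blast
  moreover have "is_packing n 3 ?X ?A"
    using packing_delete_point[OF P p] .
  moreover have "2 * card A + 4 \<le> 2 * card ?A + n"
  proof -
    have "card A = card {B \<in> A. p \<in> B} + card ?A"
      using X by (subst card_Un_disjoint[symmetric]) (auto intro: arg_cong[where f = card])
    moreover have "card {e \<in> leave_edges X A. p \<in> e} = 4"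
      using card_star[of F p] X abcd F(2) L by simp
    then have "2 * card {B \<in> A. p \<in> B} + 4 = n"
      using packing_degree[OF P p] by simp
    ultimately show ?thesis
      by linarith
  qed
  ultimately show ?thesis
    by blast
qed

text \<open>Adding the triple \<open>{p, a, b}\<close> removes a triangle from the K5; on
  \<open>a\<close>, \<open>b\<close>, \<open>c\<close>, \<open>d\<close> only the edge
  \<open>{a, b}\<close> is lost.\<close>

lemma clique_add_block:
  assumes P: "is_packing n 3 X A" and F: "F \<subseteq> X" "card F = 5"
    and L: "leave_edges X A = two_subsets F"
  shows "\<exists>A'. is_packing n 3 X A' \<and> contains_copy (leave X A') K4_minus_e \<and> card A' = Suc (card A)"
proof -
  have X: "finite X" "finite A" "finite F"
    using P F finite_blocks[of X A] finite_subset by (auto simp: is_packing_def)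
  obtain p a b c d where abcd: "F = {p, a, b, c, d}" "distinct [a, b, c, d]" "p \<notin> {a, b, c, d}"
    using F(2) by (rule card_5E)
  define T where "T = {p, a, b}"
  have uncovered: "\<not> e \<subseteq> B" if "e \<in> two_subsets F" "B \<in> A" for e B
    using that L by (auto simp: leave_edges_eq)
  have T: "T \<subseteq> X" "card T = 3" "T \<subseteq> F"
    using abcd F by (auto simp: T_def)
  have "{p, a} \<in> two_subsets F"
    using abcd by (simp add: doubleton_in_two_subsets)
  then have "T \<notin> A"
    using uncovered by (force simp: T_def)
  have "card {B \<in> insert T A. e \<subseteq> B} \<le> 1" if e: "e \<in> two_subsets X" for e
  proof (cases "e \<subseteq> T")
    case True
    then have "e \<in> two_subsets F"
      using e T by (auto simp: two_subsets_def)
    then have "{B \<in> insert T A. e \<subseteq> B} = {T}"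
      using True uncovered by auto
    then show ?thesis
      by simp
  next
    case False
    then have "{B \<in> insert T A. e \<subseteq> B} = {B \<in> A. e \<subseteq> B}"
      by auto
    then show ?thesis
      using P e by (simp add: is_packing_def)
  qed
  then have packing: "is_packing n 3 X (insert T A)"
    using P T by (simp add: is_packing_def)
  have edge: "{x, y} \<in> leave_edges X (insert T A)"
    if "x \<in> F" "y \<in> F" "x \<noteq> y" "y \<notin> T" for x y
  proof -
    have "\<not> {x, y} \<subseteq> B" if "B \<in> A" for B
      using \<open>x \<in> F\<close> \<open>y \<in> F\<close> \<open>x \<noteq> y\<close> that by (intro uncovered) (simp_all add: doubleton_in_two_subsets)
    moreover have "{x, y} \<in> two_subsets X"
      using that F by (auto simp: doubleton_in_two_subsets)
    ultimately show ?thesis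
      using \<open>y \<notin> T\<close> by (simp add: leave_edges_eq)
  qed
  have "{{a, c}, {a, d}, {b, c}, {b, d}, {c, d}} \<subseteq> leave_edges X (insert T A)"
    using edge[of a c] edge[of a d] edge[of b c] edge[of b d] edge[of c d] abcd
    by (auto simp: T_def)
  then have "contains_copy (leave X (insert T A)) K4_minus_e"
    unfolding contains_copy_K4_minus_e[OF X(1)] using abcd(2) by blast
  then show ?thesis
    using packing X \<open>T \<notin> A\<close> by (intro exI[of _ "insert T A"]) simp
qed

section \<open>Attaining the bound in each residue class\<close>

text \<open>Residues 0, 2 and 4 start from order n + 1, the odd ones from order n. The leave sizes
  come out as 3 (n/2 + 2) - n = n/2 + 6 for 0 and 2, as 3 * 3 = 9 for 1 and 3, as 10 - n + 3 (n -
  4)/2 = n/2 + 4 for 4, and as 10 - 3 = 7 for 5.\<close>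

lemma packing_with_K4_minus_e_exists:
  assumes "4 \<le> n"
  shows "\<exists>(X :: nat set) A. is_packing n 3 X A \<and> contains_copy (leave X A) K4_minus_e \<and>
    n choose 2 \<le> 3 * card A + leave_size_nat n"
proof (cases n rule: mod_6_cases)
  case (1 q)
  obtain A where A: "is_packing (6 * q + 1) 3 {..<6 * q + 1} A" "leave_edges {..<6 * q + 1} A = {}"
    using Steiner_6k1 by blast
  then have "is_packing (Suc n) 3 {..<6 * q + 1} A"
    using 1 by simp
  then obtain X' :: "nat set" and A' where A': "is_packing n 3 X' A'" "contains_copy (leave X' A') K4_minus_e"
    "2 * card A \<le> 2 * card A' + 4 + n"
    using Steiner_delete_point[OF _ A(2), of n] assms by auto
  have "3 * card A = 18 * q^2 + 3 * q"
    using packing_card[OF A(1)] A(2) choose_two_mod_6(2)[of q] by simp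
  moreover have "leave_size_nat n = 3 * q + 6"
    unfolding 1 leave_size_nat_def by simp
  ultimately have "n choose 2 \<le> 3 * card A' + leave_size_nat n"
    using A'(3) choose_two_mod_6(1)[of q, folded 1] 1 by linarith
  then show ?thesis
    using A' by blast
next
  case (2 q)
  obtain A where A: "is_packing n 3 {..<n} A" "leave_edges {..<n} A = {}"
    using Steiner_6k1 2 by metis
  then obtain A' where A': "is_packing n 3 {..<n} A'" "contains_copy (leave {..<n} A') K4_minus_e"
    "card A \<le> card A' + 3"
    using Steiner_remove_blocks assms by blast
  have "leave_size_nat n = 9"
    unfolding 2 leave_size_nat_def mod_6_simps by simp
  then have "n choose 2 \<le> 3 * card A' + leave_size_nat n"
    using packing_card[OF A(1)] A(2) A'(3) by simp
  then show ?thesis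
    using A' by blast
next
  case (3 q)
  obtain A where A: "is_packing (6 * q + 3) 3 {..<6 * q + 3} A" "leave_edges {..<6 * q + 3} A = {}"
    using Steiner_6k3 by blast
  then have "is_packing (Suc n) 3 {..<6 * q + 3} A"
    using 3 by (simp add: eval_nat_numeral)
  then obtain X' :: "nat set" and A' where A': "is_packing n 3 X' A'" "contains_copy (leave X' A') K4_minus_e"
    "2 * card A \<le> 2 * card A' + 4 + n"
    using Steiner_delete_point[OF _ A(2), of n] assms by auto
  have "3 * card A = 18 * q^2 + 15 * q + 3"
    using packing_card[OF A(1)] A(2) choose_two_mod_6(4)[of q] by simp
  moreover have "leave_size_nat n = 3 * q + 7"
    unfolding 3 leave_size_nat_def mod_6_simps by simp
  ultimately have "n choose 2 \<le> 3 * card A' + leave_size_nat n"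
    using A'(3) choose_two_mod_6(3)[of q, folded 3] 3 by linarith
  then show ?thesis
    using A' by blast
next
  case (4 q)
  obtain A where A: "is_packing n 3 {..<n} A" "leave_edges {..<n} A = {}"
    using Steiner_6k3 4 by metis
  then obtain A' where A': "is_packing n 3 {..<n} A'" "contains_copy (leave {..<n} A') K4_minus_e"
    "card A \<le> card A' + 3"
    using Steiner_remove_blocks assms by blast
  have "leave_size_nat n = 9"
    unfolding 4 leave_size_nat_def mod_6_simps by simp
  then have "n choose 2 \<le> 3 * card A' + leave_size_nat n"
    using packing_card[OF A(1)] A(2) A'(3) by simp
  then show ?thesis
    using A' by blast
next
  case (5 q)
  obtain A F where A: "is_packing (6 * q + 5) 3 {..<6 * q + 5} A"
    and F: "F \<subseteq> {..<6 * q + 5}" "card F = 5" and L: "leave_edges {..<6 * q + 5} A = two_subsets F"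
    using packing_6k5 by blast
  have "is_packing (Suc n) 3 {..<6 * q + 5} A"
    using A 5 by (simp add: eval_nat_numeral)
  then obtain X' :: "nat set" and A' where A': "is_packing n 3 X' A'" "contains_copy (leave X' A') K4_minus_e"
    "2 * card A + 4 \<le> 2 * card A' + n"
    using clique_delete_point[OF _ F L] by blast
  have "card (two_subsets F) = 10"
    using F by (simp add: card_two_subsets choose_two card_ge_0_finite)
  then have "3 * card A = 18 * q^2 + 27 * q"
    using packing_card[OF A] L choose_two_mod_6(6)[of q] by simp
  moreover have "leave_size_nat n = 3 * q + 6"
    unfolding 5 leave_size_nat_def mod_6_simps by simp
  ultimately have "n choose 2 \<le> 3 * card A' + leave_size_nat n"
    using A'(3) choose_two_mod_6(5)[of q, folded 5] 5 by linarith
  then show ?thesis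
    using A' by blast
next
  case (6 q)
  obtain A F where A: "is_packing n 3 {..<n} A"
    and F: "F \<subseteq> {..<n}" "card F = 5" and L: "leave_edges {..<n} A = two_subsets F"
    using packing_6k5 6 by metis
  obtain A' where A': "is_packing n 3 {..<n} A'" "contains_copy (leave {..<n} A') K4_minus_e"
    "card A' = Suc (card A)"
    using clique_add_block[OF A F L] by blast
  have "card (two_subsets F) = 10"
    using F by (simp add: card_two_subsets choose_two card_ge_0_finite)
  moreover have "leave_size_nat n = 7"
    unfolding 6 leave_size_nat_def mod_6_simps by simp
  ultimately have "n choose 2 \<le> 3 * card A' + leave_size_nat n"
    using packing_card[OF A] L A'(3) by simp
  then show ?thesis
    using A' by blast
qed

theorem theorem4p5:
  fixes n :: nat
  assumes "n \<ge> 4"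
  shows "real (max_packing n 3 K4_minus_e) = 1 / 3 * (real (n choose 2) - leave_size n)"
proof -
  define S where "S = {card A | (X :: nat set) A. is_packing n 3 X A \<and> contains_copy (leave X A) K4_minus_e}"
  have upper: "3 * s + leave_size_nat n \<le> n choose 2" if "s \<in> S" for s
    using that packing_with_K4_minus_e_bound unfolding S_def by blast
  obtain X :: "nat set" and A where A: "is_packing n 3 X A" "contains_copy (leave X A) K4_minus_e"
    "n choose 2 \<le> 3 * card A + leave_size_nat n"
    using packing_with_K4_minus_e_exists[OF assms] by blast
  then have mem: "card A \<in> S"
    unfolding S_def by blast
  have eq: "3 * card A + leave_size_nat n = n choose 2"
    using upper[OF mem] A(3) by simp
  have le: "s \<le> card A" if "s \<in> S" for s
    using upper[OF that] eq by simp
  \<comment> \<open>The bound by \<open>card A\<close> makes \<open>S\<close> finite, so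
    \<open>Max\<close> is a genuine maximum.\<close>
  then have "finite S"
    by (meson finite_nat_set_iff_bounded_le)
  then have "max_packing n 3 K4_minus_e = card A"
    unfolding max_packing_def S_def[symmetric] using le mem by (intro Max_eqI)
  then show ?thesis
    unfolding leave_size_eq eq[symmetric] by simp
qed

end
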